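(* The Schubert cells of the odd symplectic flag manifold $\mathbb{F}_\omega(E)$ are the orbits of the Borel subgroup $B$ of $\mathrm{Sp}_{2n+1}$ acting on $\mathbb{F}_\omega(E)$.
   Context: $E$ is a complex vector space of dimension $2n+1$ with a skew-form $\omega$ of rank $2n$, contained as a hyperplane in a complex vector space $\tilde E$ of dimension $2n+2$ with a symplectic form $\tilde\omega$ extending $\omega$. Fix a basis $\{e_0,\dots,e_{2n+1}\}$ of $\tilde E$ such that $E=\langle e_0,\dots,e_{2n}\rangle$ and, with $\bar\imath=2n+1-i$, $\tilde\omega(e_i,e_j)=0$ unless $j=\bar\imath$ and $\tilde\omega(e_i,e_{\bar\imath})=1$ for $0\le i\le n$. Put $F_j=\langle e_0,\dots,e_j\rangle$ for $0\le j\le 2n+1$. $\mathrm{Sp}_{2n+1}$ is the stabilizer of $\omega$ in $\mathrm{GL}(E)$ and $B$ is its Borel subgroup preserving the flag $F_0\subset F_1\subset\cdots\subset F_{2n}=E$ (the elements upper triangular in the basis $\{e_0,\dots,e_{2n}\}$). $\mathbb{F}_\omega(E)$ (resp. $\mathbb{F}_{\tilde\omega}(\tilde E)$) is the variety of flags $(V_1\subset\cdots\subset V_{n+1})$, $\dim V_i=i$, of isotropic subspaces of $E$ (resp. $\tilde E$); $\mathbb{F}_\omega(E)$ is identified with the set of flags in $\mathbb{F}_{\tilde\omega}(\tilde E)$ with $V_{n+1}\subset E$. Let $W(\mathrm{Sp}_{2n+2})$ be the group of permutations $w$ of $\{0,\dots,2n+1\}$ with $w(\bar\imath)=\overline{w(i)}$.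 For $w\in W(\mathrm{Sp}_{2n+2})$ the Schubert cell $C_w$ of $\mathbb{F}_{\tilde\omega}(\tilde E)$ is the set of flags $V_\bullet\in\mathbb{F}_{\tilde\omega}(\tilde E)$ with $\dim(V_{i+1}\cap F_j)=\#\{k\mid 0\le k\le i,\ w(k)\le j\}$ for all $0\le i\le n$, $0\le j\le2n+1$. $\mathbb{F}_\omega(E)$ is a Schubert variety, hence a union of such cells, and the Schubert cells of $\mathbb{F}_\omega(E)$ are by definition the Schubert cells of $\mathbb{F}_{\tilde\omega}(\tilde E)$ contained in $\mathbb{F}_\omega(E)$. *)

theory Defs
  imports
    Complex_Main
    "HOL-Combinatorics.Permutations"
    "HOL-Algebra.Group_Action"
begin

text \<open>
  Complex vector spaces are given by a scalar multiplication
  \<open>scale :: complex \<Rightarrow> 'v \<Rightarrow> 'v\<close> on an additive group \<open>'v\<close>.  The whole type plays the role of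
  the even-dimensional space; the odd-dimensional space is a subspace \<open>E\<close> of it.
\<close>

section \<open>Skew forms on subspaces\<close>

text \<open>The values of a form outside of \<open>E \<times> E\<close> are irrelevant.\<close>

definition skew_form_on ::
  "(complex \<Rightarrow> 'v \<Rightarrow> 'v) \<Rightarrow> 'v set \<Rightarrow> ('v::ab_group_add \<Rightarrow> 'v \<Rightarrow> complex) \<Rightarrow> bool" where
  "skew_form_on scale E \<omega> \<longleftrightarrow>
     (\<forall>u\<in>E. \<forall>v\<in>E. \<forall>w\<in>E. \<omega> (u + v) w = \<omega> u w + \<omega> v w \<and> \<omega> w (u + v) = \<omega> w u + \<omega> w v) \<and>
     (\<forall>c. \<forall>u\<in>E. \<forall>v\<in>E. \<omega> (scale c u) v = c * \<omega> u v \<and> \<omega> u (scale c v) = c * \<omega> u v) \<and>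
     (\<forall>u\<in>E. \<forall>v\<in>E. \<omega> u v = - \<omega> v u)"

definition form_kernel :: "'v set \<Rightarrow> ('v \<Rightarrow> 'v \<Rightarrow> complex) \<Rightarrow> 'v set" where
  "form_kernel E \<omega> = {u \<in> E. \<forall>v\<in>E. \<omega> u v = 0}"

text \<open>The rank is that of the linear map from \<open>E\<close> to its dual induced by the form.\<close>

definition form_rank ::
  "(complex \<Rightarrow> 'v \<Rightarrow> 'v) \<Rightarrow> 'v set \<Rightarrow> ('v::ab_group_add \<Rightarrow> 'v \<Rightarrow> complex) \<Rightarrow> nat" where
  "form_rank scale E \<omega> = vector_space.dim scale E - vector_space.dim scale (form_kernel E \<omega>)"

definition symplectic_form_on ::
  "(complex \<Rightarrow> 'v \<Rightarrow> 'v) \<Rightarrow> 'v set \<Rightarrow> ('v::ab_group_add \<Rightarrow> 'v \<Rightarrow> complex) \<Rightarrow> bool" where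
  "symplectic_form_on scale E \<omega> \<longleftrightarrow> skew_form_on scale E \<omega> \<and> form_kernel E \<omega> = {0}"


section \<open>Flags of isotropic subspaces\<close>

text \<open>A flag \<open>V\<^sub>1 \<subset> \<dots> \<subset> V\<^sub>m\<close> is a function that is \<open>undefined\<close> outside of \<open>{1..m}\<close>, so that
  equality of flags is equality of functions.\<close>

definition isotropic_flags ::
  "(complex \<Rightarrow> 'v \<Rightarrow> 'v) \<Rightarrow> 'v set \<Rightarrow> ('v::ab_group_add \<Rightarrow> 'v \<Rightarrow> complex) \<Rightarrow> nat \<Rightarrow>
    (nat \<Rightarrow> 'v set) set" where
  "isotropic_flags scale E \<omega> m =
     {V \<in> extensional {1..m}.
        (\<forall>i\<in>{1..m}. module.subspace scale (V i) \<and> V i \<subseteq> E \<and> vector_space.dim scale (V i) = i \<and>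
                    (\<forall>u\<in>V i. \<forall>v\<in>V i. \<omega> u v = 0)) \<and>
        (\<forall>i\<in>{1..<m}. V i \<subset> V (i + 1))}"

definition std_flag ::
  "(complex \<Rightarrow> 'v \<Rightarrow> 'v) \<Rightarrow> (nat \<Rightarrow> 'v::ab_group_add) \<Rightarrow> nat \<Rightarrow> 'v set" where
  "std_flag scale e j = module.span scale (e ` {..j})"


section \<open>Schubert cells\<close>

definition conj_index :: "nat \<Rightarrow> nat \<Rightarrow> nat" where
  "conj_index n i = 2 * n + 1 - i"

definition weyl_Sp_even :: "nat \<Rightarrow> (nat \<Rightarrow> nat) set" where
  "weyl_Sp_even n =
     {w. w permutes {0..2 * n + 1} \<and>
         (\<forall>i\<in>{0..2 * n + 1}. w (conj_index n i) = conj_index n (w i))}"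

definition schubert_cell ::
  "(complex \<Rightarrow> 'v \<Rightarrow> 'v) \<Rightarrow> ('v::ab_group_add \<Rightarrow> 'v \<Rightarrow> complex) \<Rightarrow> (nat \<Rightarrow> 'v) \<Rightarrow> nat \<Rightarrow>
    (nat \<Rightarrow> nat) \<Rightarrow> (nat \<Rightarrow> 'v set) set" where
  "schubert_cell scale \<omega>' e n w =
     {V \<in> isotropic_flags scale UNIV \<omega>' (n + 1).
        \<forall>i\<in>{0..n}. \<forall>j\<in>{0..2 * n + 1}.
          vector_space.dim scale (V (i + 1) \<inter> std_flag scale e j) = card {k \<in> {0..i}. w k \<le> j}}"

definition odd_schubert_cells ::
  "(complex \<Rightarrow> 'v \<Rightarrow> 'v) \<Rightarrow> 'v set \<Rightarrow> ('v::ab_group_add \<Rightarrow> 'v \<Rightarrow> complex) \<Rightarrow>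
    ('v \<Rightarrow> 'v \<Rightarrow> complex) \<Rightarrow> (nat \<Rightarrow> 'v) \<Rightarrow> nat \<Rightarrow> (nat \<Rightarrow> 'v set) set set" where
  "odd_schubert_cells scale E \<omega> \<omega>' e n =
     {schubert_cell scale \<omega>' e n w | w.
        w \<in> weyl_Sp_even n \<and>
        schubert_cell scale \<omega>' e n w \<subseteq> isotropic_flags scale E \<omega> (n + 1)}"


section \<open>The odd symplectic group and its Borel subgroup\<close>

definition linear_on ::
  "(complex \<Rightarrow> 'v \<Rightarrow> 'v) \<Rightarrow> 'v set \<Rightarrow> ('v::ab_group_add \<Rightarrow> 'v) \<Rightarrow> bool" where
  "linear_on scale E g \<longleftrightarrow>
     (\<forall>u\<in>E. \<forall>v\<in>E. g (u + v) = g u + g v) \<and> (\<forall>c. \<forall>u\<in>E. g (scale c u) = scale c (g u))"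

definition GL_group ::
  "(complex \<Rightarrow> 'v \<Rightarrow> 'v) \<Rightarrow> 'v set \<Rightarrow> ('v::ab_group_add \<Rightarrow> 'v) monoid" where
  "GL_group scale E = (BijGroup E)\<lparr>carrier := {g \<in> Bij E. linear_on scale E g}\<rparr>"

definition Sp_group ::
  "(complex \<Rightarrow> 'v \<Rightarrow> 'v) \<Rightarrow> 'v set \<Rightarrow> ('v::ab_group_add \<Rightarrow> 'v \<Rightarrow> complex) \<Rightarrow> ('v \<Rightarrow> 'v) monoid" where
  "Sp_group scale E \<omega> =
     (GL_group scale E)\<lparr>carrier :=
        {g \<in> carrier (GL_group scale E). \<forall>u\<in>E. \<forall>v\<in>E. \<omega> (g u) (g v) = \<omega> u v}\<rparr>"

definition borel_Sp_odd ::
  "(complex \<Rightarrow> 'v \<Rightarrow> 'v) \<Rightarrow> 'v set \<Rightarrow> ('v::ab_group_add \<Rightarrow> 'v \<Rightarrow> complex) \<Rightarrow> (nat \<Rightarrow> 'v) \<Rightarrow> nat \<Rightarrow>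
    ('v \<Rightarrow> 'v) monoid" where
  "borel_Sp_odd scale E \<omega> e n =
     (Sp_group scale E \<omega>)\<lparr>carrier :=
        {g \<in> carrier (Sp_group scale E \<omega>).
           \<forall>j\<in>{0..2 * n}. g ` std_flag scale e j = std_flag scale e j}\<rparr>"

text \<open>The restriction to the set of flags makes each \<open>flag_action scale E \<omega> m g\<close> an element of
  \<open>BijGroup\<close> of that set, as required by \<^locale>\<open>group_action\<close>.\<close>

definition flag_action ::
  "(complex \<Rightarrow> 'v \<Rightarrow> 'v) \<Rightarrow> 'v set \<Rightarrow> ('v::ab_group_add \<Rightarrow> 'v \<Rightarrow> complex) \<Rightarrow> nat \<Rightarrow>
    ('v \<Rightarrow> 'v) \<Rightarrow> (nat \<Rightarrow> 'v set) \<Rightarrow> (nat \<Rightarrow> 'v set)" where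
  "flag_action scale E \<omega> m g =
     (\<lambda>V \<in> isotropic_flags scale E \<omega> m. \<lambda>i\<in>{1..m}. g ` V i)"

lemma linear_on_image:
  assumes "vector_space scale" "linear_on scale E g" "inj_on g E"
    and V: "module.subspace scale V" "V \<subseteq> E"
  shows "module.subspace scale (g ` V)"
    and "vector_space.dim scale (g ` V) = vector_space.dim scale V"
proof -
  interpret vector_space scale by fact
  interpret vector_space_pair scale scale ..
  obtain B where B: "B \<subseteq> V" "independent B" "V = span B"
    using maximal_independent_subset[of V] span_minimal[OF _ V(1)] by (metis subset_antisym)
  obtain h where h: "Vector_Spaces.linear scale scale h" "\<forall>x\<in>B. h x = g x"
    using linear_independent_extend[OF B(2), of g] by blast
  interpret h: Vector_Spaces.linear scale scale h by fact
  have "x \<in> V \<and> h x = g x" if "x \<in> span B" for x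
    using that
  proof (induction rule: span_induct_alt)
    case base
    have "0 \<in> V" using V subspace_0 by blast
    moreover have "g (scale 0 0) = scale 0 (g 0)"
      using assms(2) V(2) calculation unfolding linear_on_def by blast
    ultimately show ?case by (simp add: h.zero)
  next
    case (step c x y)
    then have "x \<in> V" "scale c x \<in> V" "y \<in> V" using B V subspace_scale by auto
    then have in_E: "x \<in> E" "scale c x \<in> E" "y \<in> E" using V(2) by auto
    have "g (scale c x + y) = scale c (g x) + g y"
      using assms(2) in_E by (simp add: linear_on_def)
    moreover have "h (scale c x + y) = scale c (g x) + g y"
      using step h(2) by (simp add: h.add h.scale)
    moreover have "scale c x + y \<in> V"
      using \<open>scale c x \<in> V\<close> \<open>y \<in> V\<close> V(1) subspace_add by blast
    ultimately show ?case by simp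
  qed
  then have hg: "h x = g x" if "x \<in> V" for x using that B(3) by blast
  then have im: "h ` V = g ` V" by auto
  have inj: "inj_on h V"
    using inj_on_subset[OF assms(3) V(2)] hg by (simp add: inj_on_def)
  show "subspace (g ` V)" using im h.subspace_image V(1) by metis
  have ind: "independent (h ` B)"
    using h.independent_injective_image[OF B(2)] inj B(3) by blast
  have "dim (g ` V) = card (h ` B)"
    using dim_span_eq_card_independent[OF ind] im h.span_image B(3) by metis
  also have "\<dots> = card B" using inj B(1) by (meson card_image inj_on_subset)
  also have "\<dots> = dim V" using dim_span_eq_card_independent[OF B(2)] B(3) by simp
  finally show "dim (g ` V) = dim V" .
qed

lemma borel_Sp_odd_carrier:
  "carrier (borel_Sp_odd scale E \<omega> e n) =
    {g \<in> Bij E. linear_on scale E g \<and> (\<forall>u\<in>E. \<forall>v\<in>E. \<omega> (g u) (g v) = \<omega> u v) \<and>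
       (\<forall>j\<in>{0..2 * n}. g ` std_flag scale e j = std_flag scale e j)}"
  by (auto simp: borel_Sp_odd_def Sp_group_def GL_group_def)

lemma borel_Sp_odd_eq:
  "borel_Sp_odd scale E \<omega> e n =
    (BijGroup E)\<lparr>carrier := carrier (borel_Sp_odd scale E \<omega> e n)\<rparr>"
  by (simp add: borel_Sp_odd_def Sp_group_def GL_group_def)

lemma subgroup_borel_Sp_odd:
  assumes "vector_space scale" and E: "E = std_flag scale e (2 * n)"
  shows "subgroup (carrier (borel_Sp_odd scale E \<omega> e n)) (BijGroup E)"
proof -
  interpret vector_space scale by fact
  interpret G: group "BijGroup E" by (rule group_BijGroup)
  have subE: "subspace E" by (simp add: E std_flag_def)
  have F: "std_flag scale e j \<subseteq> E" if "j \<le> 2 * n" for j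
    unfolding E std_flag_def using that by (intro span_mono image_mono) auto
  show ?thesis
  proof (rule G.subgroupI)
    show "carrier (borel_Sp_odd scale E \<omega> e n) \<subseteq> carrier (BijGroup E)"
      by (auto simp: borel_Sp_odd_carrier BijGroup_def)
    have "(\<lambda>x\<in>E. x) \<in> carrier (borel_Sp_odd scale E \<omega> e n)"
      using subE F
      by (auto simp: borel_Sp_odd_carrier id_Bij linear_on_def subspace_add subspace_scale image_iff subset_iff)
    then show "carrier (borel_Sp_odd scale E \<omega> e n) \<noteq> {}" by blast
  next
    fix g assume g: "g \<in> carrier (borel_Sp_odd scale E \<omega> e n)"
    then have gB: "g \<in> Bij E" by (simp add: borel_Sp_odd_carrier)
    define h where "h = (\<lambda>x\<in>E. inv_into E g x)"
    have bij: "bij_betw g E E" using gB by (simp add: Bij_def)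
    have hE: "h x \<in> E" "g (h x) = x" if "x \<in> E" for x
      using that bij by (auto simp: h_def bij_betw_def f_inv_into_f inv_into_into)
    have hg: "h (g x) = x" if "x \<in> E" for x
      using that bij by (auto simp: h_def bij_betw_def)
    have gE: "g x \<in> E" if "x \<in> E" for x using that bij by (auto simp: bij_betw_def)
    have lin: "g (u + v) = g u + g v" "g (scale c u) = scale c (g u)" if "u \<in> E" "v \<in> E" for u v c
      using g that by (auto simp: borel_Sp_odd_carrier linear_on_def)
    have "linear_on scale E h"
      unfolding linear_on_def
      by (metis hE hg lin subE subspace_add subspace_scale)
    moreover have "\<omega> (h u) (h v) = \<omega> u v" if "u \<in> E" "v \<in> E" for u v
      using g that hE by (simp add: borel_Sp_odd_carrier) metis
    moreover have "h ` std_flag scale e j = std_flag scale e j" if "j \<le> 2 * n" for j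
    proof -
      have "h ` std_flag scale e j = h ` g ` std_flag scale e j"
        using g that by (simp add: borel_Sp_odd_carrier)
      also have "\<dots> = std_flag scale e j"
        using F[OF that] hg by (force simp: image_image)
      finally show ?thesis .
    qed
    ultimately show "inv\<^bsub>BijGroup E\<^esub> g \<in> carrier (borel_Sp_odd scale E \<omega> e n)"
      using inv_BijGroup[OF gB] restrict_inv_into_Bij[OF gB]
      by (simp add: borel_Sp_odd_carrier h_def)
  next
    fix g h
    assume g: "g \<in> carrier (borel_Sp_odd scale E \<omega> e n)"
      and h: "h \<in> carrier (borel_Sp_odd scale E \<omega> e n)"
    then have B: "g \<in> Bij E" "h \<in> Bij E" by (auto simp: borel_Sp_odd_carrier)
    have hE: "h x \<in> E" if "x \<in> E" for x using that Bij_imp_funcset[OF B(2)] by auto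
    have "linear_on scale E (compose E g h)"
      using g h hE subE
      by (auto simp: borel_Sp_odd_carrier linear_on_def compose_eq subspace_add subspace_scale)
    moreover have "\<omega> (compose E g h u) (compose E g h v) = \<omega> u v" if "u \<in> E" "v \<in> E" for u v
      using g h that hE by (simp add: borel_Sp_odd_carrier compose_eq)
    moreover have "compose E g h ` std_flag scale e j = std_flag scale e j" if "j \<le> 2 * n" for j
    proof -
      have "compose E g h ` std_flag scale e j = g ` h ` std_flag scale e j"
        using F[OF that] by (force simp: compose_eq image_image)
      also have "\<dots> = std_flag scale e j"
        using g h that by (simp add: borel_Sp_odd_carrier)
      finally show ?thesis .
    qed
    ultimately show "g \<otimes>\<^bsub>BijGroup E\<^esub> h \<in> carrier (borel_Sp_odd scale E \<omega> e n)"
      using B compose_Bij[OF B]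
      by (simp add: borel_Sp_odd_carrier BijGroup_def)
  qed
qed

theorem group_action_flag_action:
  assumes "vector_space scale" and E: "E = std_flag scale e (2 * n)"
  shows "group_action (borel_Sp_odd scale E \<omega> e n) (isotropic_flags scale E \<omega> m)
           (flag_action scale E \<omega> m)"
proof -
  let ?G = "borel_Sp_odd scale E \<omega> e n" and ?X = "isotropic_flags scale E \<omega> m"
  let ?\<phi> = "flag_action scale E \<omega> m"
  interpret vector_space scale by fact
  interpret S: group "BijGroup E" by (rule group_BijGroup)
  have subE: "subspace E" by (simp add: E std_flag_def)
  have sub: "subgroup (carrier ?G) (BijGroup E)" by (rule subgroup_borel_Sp_odd[OF assms])
  interpret G: group ?G
    using subgroup.subgroup_is_group[OF sub S.is_group] borel_Sp_odd_eq by metis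
  have mult: "g \<otimes>\<^bsub>?G\<^esub> h = compose E g h" if "g \<in> carrier ?G" "h \<in> carrier ?G" for g h
    using that by (simp add: borel_Sp_odd_def Sp_group_def GL_group_def BijGroup_def)
  have one: "\<one>\<^bsub>?G\<^esub> = (\<lambda>x\<in>E. x)"
    by (simp add: borel_Sp_odd_def Sp_group_def GL_group_def BijGroup_def)
  have mem: "?\<phi> g V \<in> ?X" if g: "g \<in> carrier ?G" and V: "V \<in> ?X" for g V
  proof -
    have inj: "inj_on g E" and gE: "g ` E = E"
      and lin: "linear_on scale E g" and om: "\<forall>u\<in>E. \<forall>v\<in>E. \<omega> (g u) (g v) = \<omega> u v"
      using g by (auto simp: borel_Sp_odd_carrier Bij_def bij_betw_def)
    have "subspace (g ` V i) \<and> g ` V i \<subseteq> E \<and> dim (g ` V i) = i \<and>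
          (\<forall>u\<in>g ` V i. \<forall>v\<in>g ` V i. \<omega> u v = 0)" if "i \<in> {1..m}" for i
    proof -
      have Vi: "subspace (V i)" "V i \<subseteq> E" "dim (V i) = i" "\<forall>u\<in>V i. \<forall>v\<in>V i. \<omega> u v = 0"
        using V that by (auto simp: isotropic_flags_def)
      show ?thesis
        using linear_on_image[OF assms(1) lin inj Vi(1,2)] Vi gE om
        by (auto simp: subset_iff)
    qed
    moreover have "g ` V i \<subset> g ` V (i + 1)" if "i \<in> {1..<m}" for i
    proof -
      have *: "V i \<subset> V (i + 1)" using V that by (auto simp: isotropic_flags_def)
      have "V (i + 1) \<subseteq> E" using V that by (simp add: isotropic_flags_def)
      then show ?thesis using * inj by (meson image_strict_mono inj_on_subset)
    qed
    ultimately show ?thesis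
      using V by (simp add: flag_action_def) (simp add: isotropic_flags_def)
  qed
  have comp: "?\<phi> (compose E g h) V = ?\<phi> g (?\<phi> h V)"
    if "g \<in> carrier ?G" and "h \<in> carrier ?G" and V: "V \<in> ?X" for g h V
  proof -
    have "compose E g h ` V i = g ` h ` V i" if "i \<in> {1..m}" for i
    proof -
      have "V i \<subseteq> E" using V that by (simp add: isotropic_flags_def)
      then show ?thesis by (force simp: compose_eq image_image)
    qed
    then show ?thesis
      using mem[OF that(2) V] V by (auto simp: flag_action_def restrict_def fun_eq_iff)
  qed
  have act1: "?\<phi> (\<lambda>x\<in>E. x) V = V" if V: "V \<in> ?X" for V
  proof
    fix i
    show "?\<phi> (\<lambda>x\<in>E. x) V i = V i"
    proof (cases "i \<in> {1..m}")
      case True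
      then have "V i \<subseteq> E" using V by (simp add: isotropic_flags_def)
      then show ?thesis using V True by (force simp: flag_action_def)
    next
      case False
      then show ?thesis using V
        by (simp only: flag_action_def) (auto simp: isotropic_flags_def extensional_def)
    qed
  qed
  have bij: "?\<phi> g \<in> Bij ?X" if g: "g \<in> carrier ?G" for g
  proof -
    let ?h = "inv\<^bsub>?G\<^esub> g"
    have h: "?h \<in> carrier ?G" using g by simp
    have "?\<phi> ?h (?\<phi> g V) = V" "?\<phi> g (?\<phi> ?h V) = V" if "V \<in> ?X" for V
      using comp[OF h g that] comp[OF g h that] mult[OF h g] mult[OF g h] one act1[OF that]
        G.l_inv[OF g] G.r_inv[OF g] by metis+
    then have "bij_betw (?\<phi> g) ?X ?X"
      using mem[OF g] mem[OF h] by (intro bij_betw_byWitness[where f' = "?\<phi> ?h"]) auto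
    then show ?thesis by (simp add: Bij_def flag_action_def)
  qed
  have "?\<phi> (g \<otimes>\<^bsub>?G\<^esub> h) = ?\<phi> g \<otimes>\<^bsub>BijGroup ?X\<^esub> ?\<phi> h"
    if "g \<in> carrier ?G" "h \<in> carrier ?G" for g h
  proof
    fix V
    show "?\<phi> (g \<otimes>\<^bsub>?G\<^esub> h) V = (?\<phi> g \<otimes>\<^bsub>BijGroup ?X\<^esub> ?\<phi> h) V"
      using comp[OF that] mult[OF that] bij[OF that(1)] bij[OF that(2)]
      by (cases "V \<in> ?X") (simp_all add: BijGroup_def compose_def, simp add: flag_action_def)
  qed
  then have "?\<phi> \<in> hom ?G (BijGroup ?X)"
    using bij by (auto simp: hom_def BijGroup_def)
  then show ?thesis
    by (simp add: group_action_def group_hom_def group_hom_axioms_def group_BijGroup G.is_group)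
qed

end

theory Submission
  imports Defs
begin

text \<open>
  The theorem is a Bruhat decomposition. Work first in the even symplectic space with its
  symplectic basis \<open>e\<close>. For every complete isotropic flag \<open>V\<close> there is a second symplectic basis \<open>f\<close>
  adapted to both flags: \<open>f i \<in> F i\<close>, and each \<open>V (i + 1)\<close> is spanned by \<open>f (w 0), \<dots>, f (w i)\<close> for
  an element \<open>w\<close> of the Weyl group. It is built one hyperbolic plane at a time
  (\<open>adapted_step\<close>): a vector \<open>v \<in> V (k + 1)\<close> orthogonal to the planes found so far has a leading
  index \<open>p\<close> with respect to \<open>e\<close>, and a partner is found in \<open>F (N - p)\<close>. Orthogonal projection
  away from the earlier planes preserves both flags, because an adapted vector outside of \<open>F j\<close>
  has its partner in the orthogonal space of \<open>F j\<close>.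

  The linear map sending \<open>e i\<close> to \<open>f i\<close> preserves the form, hence is injective, and by counting
  dimensions it preserves every \<open>F j\<close> and carries the coordinate flag of \<open>w\<close> to \<open>V\<close>
  (\<open>bruhat_decomposition\<close>). Since \<open>E = F (2 * n)\<close> is one of the preserved subspaces, the map
  restricts to an element of the Borel subgroup of the odd symplectic group
  (\<open>odd_bruhat_decomposition\<close>). Passing to \<open>E\<close> thus costs nothing beyond this restriction.

  It remains to match orbits with cells. The Borel subgroup preserves the dimensions that define a
  cell, so it preserves cells; each cell contains exactly one coordinate flag; and
  whether a flag lies in \<open>E\<close> can be read off from the dimension of its last
  step intersected with \<open>F (2 * n)\<close>, so a cell meeting the odd flag variety is contained in it.
  Therefore both the orbit and the cell of a flag are determined by the coordinate flag reached from it,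
  and they coincide (\<open>orbit_eq_cell\<close>).
\<close>

section \<open>Spaces with a symplectic basis\<close>

locale symplectic_basis = vector_space scale
  for scale :: "complex \<Rightarrow> 'v::ab_group_add \<Rightarrow> 'v" +
  fixes \<omega> :: "'v \<Rightarrow> 'v \<Rightarrow> complex" and e :: "nat \<Rightarrow> 'v" and n :: nat
  assumes skew: "skew_form_on scale UNIV \<omega>"
    and inj_basis: "inj_on e {0..2 * n + 1}"
    and independent_basis: "independent (e ` {0..2 * n + 1})"
    and span_basis: "span (e ` {0..2 * n + 1}) = UNIV"
    and antidiagonal:
      "\<forall>i\<in>{0..2 * n + 1}. \<forall>j\<in>{0..2 * n + 1}. j \<noteq> conj_index n i \<longrightarrow> \<omega> (e i) (e j) = 0"
    and pairing: "\<forall>i\<in>{0..n}. \<omega> (e i) (e (conj_index n i)) = 1"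

sublocale symplectic_basis \<subseteq> finite_dimensional_vector_space scale "e ` {0..2 * n + 1}"
  by unfold_locales (use independent_basis span_basis in auto)

context symplectic_basis
begin

abbreviation N :: nat where "N \<equiv> 2 * n + 1"

abbreviation F :: "nat \<Rightarrow> 'v set" where "F \<equiv> std_flag scale e"

lemma form_add_left: "\<omega> (x + y) z = \<omega> x z + \<omega> y z"
  and form_add_right: "\<omega> z (x + y) = \<omega> z x + \<omega> z y"
  and form_scale_left: "\<omega> (scale c x) y = c * \<omega> x y"
  and form_scale_right: "\<omega> x (scale c y) = c * \<omega> x y"
  and form_swap: "\<omega> x y = - \<omega> y x"
  using skew unfolding skew_form_on_def by blast+

lemma form_self: "\<omega> x x = 0"
proof -
  have "\<omega> x x + \<omega> x x = 0" using form_swap[of x x] by (metis add.right_inverse)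
  then show ?thesis by (simp flip: mult_2)
qed

lemma form_zero_left: "\<omega> 0 y = 0" and form_zero_right: "\<omega> y 0 = 0"
  using form_scale_left[of 0 0 y] form_scale_right[of y 0 0] by simp_all

lemma form_diff_left: "\<omega> (x - y) z = \<omega> x z - \<omega> y z"
  using form_add_left[of "x - y" y z] by simp

lemma form_sum_left: "\<omega> (sum f A) y = (\<Sum>i\<in>A. \<omega> (f i) y)"
  by (induction A rule: infinite_finite_induct) (simp_all add: form_zero_left form_add_left)

lemma form_basis_eq_0: "\<lbrakk>i \<le> N; j \<le> N; i + j \<noteq> N\<rbrakk> \<Longrightarrow> \<omega> (e i) (e j) = 0"
  using antidiagonal by (auto simp: conj_index_def)

lemma form_basis_conj_neq_0: "i \<le> N \<Longrightarrow> \<omega> (e i) (e (N - i)) \<noteq> 0"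
proof (cases "i \<le> n")
  case True
  then show ?thesis using pairing by (simp add: conj_index_def)
next
  case False
  moreover assume "i \<le> N"
  ultimately have "\<omega> (e (N - i)) (e i) = 1"
    using pairing[rule_format, of "N - i"] by (simp add: conj_index_def)
  then show ?thesis using form_swap[of "e i" "e (N - i)"] by simp
qed

lemma form_span_eq_0:
  assumes "y \<in> span S" "\<And>s. s \<in> S \<Longrightarrow> \<omega> x s = 0"
  shows "\<omega> x y = 0"
  using assms(1)
  by (induction rule: span_induct_alt) (simp_all add: form_zero_right form_add_right form_scale_right assms(2))

lemma form_sum_antidiagonal:
  assumes I: "finite I" "j \<in> I"
    and gram: "\<And>i. i \<in> I \<Longrightarrow> i \<noteq> j \<Longrightarrow> \<omega> (f i) y = 0"
  shows "\<omega> (\<Sum>i\<in>I. scale (c i) (f i)) y = c j * \<omega> (f j) y"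
proof -
  have "\<omega> (\<Sum>i\<in>I. scale (c i) (f i)) y = (\<Sum>i\<in>I. c i * \<omega> (f i) y)"
    by (simp add: form_sum_left form_scale_left)
  also have "\<dots> = (\<Sum>i\<in>I. if i = j then c j * \<omega> (f j) y else 0)"
    by (rule sum.cong) (auto simp: gram)
  finally show ?thesis using I by simp
qed

text \<open>
  The coefficient of \<open>e (N - i)\<close> in \<open>x\<close> is \<open>\<omega> x (e i)\<close> up to sign, so coordinate subspaces are cut
  out by the form. In this description intersecting coordinate subspaces is immediate, and so is
  the fact that the orthogonal space of \<open>F j\<close> is \<open>F (N - 1 - j)\<close>.
\<close>

lemma mem_span_basis_iff:
  assumes A: "A \<subseteq> {0..N}"
  shows "x \<in> span (e ` A) \<longleftrightarrow> (\<forall>i\<le>N. N - i \<notin> A \<longrightarrow> \<omega> x (e i) = 0)"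
proof
  assume x: "x \<in> span (e ` A)"
  show "\<forall>i\<le>N. N - i \<notin> A \<longrightarrow> \<omega> x (e i) = 0"
  proof (intro allI impI)
    fix i assume i: "i \<le> N" "N - i \<notin> A"
    have fresh: "k + i \<noteq> N" if "k \<in> A" for k
      using that i(2) by (metis add_diff_cancel_right')
    have "\<omega> (e i) x = 0"
    proof (rule form_span_eq_0[OF x])
      fix s assume "s \<in> e ` A"
      then obtain k where k: "k \<in> A" "s = e k" by blast
      then have "k \<le> N" "i + k \<noteq> N" using A fresh[of k] by auto
      then show "\<omega> (e i) s = 0" using k i form_basis_eq_0 by simp
    qed
    then show "\<omega> x (e i) = 0" using form_swap[of x "e i"] by simp
  qed
next
  assume zero: "\<forall>i\<le>N. N - i \<notin> A \<longrightarrow> \<omega> x (e i) = 0"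
  have "x \<in> span (e ` {0..N})" using span_basis by simp
  then obtain u where "x = (\<Sum>v\<in>e ` {0..N}. scale (u v) v)"
    by (auto simp: span_finite)
  then have x: "x = (\<Sum>i\<in>{0..N}. scale (u (e i)) (e i))"
    using sum.reindex[OF inj_basis, of "\<lambda>v. scale (u v) v"] unfolding comp_def by argo
  have "scale (u (e i)) (e i) \<in> span (e ` A)" if i: "i \<in> {0..N}" for i
  proof (cases "i \<in> A")
    case True
    then show ?thesis by (intro span_scale span_base) auto
  next
    case False
    have "\<omega> x (e (N - i)) = u (e i) * \<omega> (e i) (e (N - i))"
      unfolding x by (rule form_sum_antidiagonal) (use i form_basis_eq_0 in auto)
    moreover have "\<omega> x (e (N - i)) = 0" using zero False i by simp
    ultimately have "u (e i) = 0" using form_basis_conj_neq_0[of i] i by simp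
    then show ?thesis by (simp add: span_zero)
  qed
  then show "x \<in> span (e ` A)" by (subst x) (rule span_sum)
qed

lemma mem_std_flag_iff:
  assumes "j \<le> N"
  shows "x \<in> F j \<longleftrightarrow> (\<forall>i. i + j < N \<longrightarrow> \<omega> x (e i) = 0)"
proof -
  have "{..j} \<subseteq> {0..N}" using assms by auto
  then have "x \<in> F j \<longleftrightarrow> (\<forall>i\<le>N. N - i \<notin> {..j} \<longrightarrow> \<omega> x (e i) = 0)"
    unfolding std_flag_def by (rule mem_span_basis_iff)
  moreover have "i \<le> N \<and> N - i \<notin> {..j} \<longleftrightarrow> i + j < N" for i by auto
  ultimately show ?thesis by blast
qed

lemma subspace_std_flag: "subspace (F j)"
  by (simp add: std_flag_def)

lemma basis_mem_std_flag: "i \<le> j \<Longrightarrow> e i \<in> F j"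
  by (auto simp: std_flag_def intro: span_base)

lemma std_flag_mono: "i \<le> j \<Longrightarrow> F i \<subseteq> F j"
  unfolding std_flag_def by (intro span_mono image_mono) auto

lemma std_flag_top: "F N = UNIV"
  using span_basis by (simp add: std_flag_def atLeast0AtMost)

lemma std_flag_orthogonal:
  assumes "x \<in> F i" "y \<in> F j" "i + j < N"
  shows "\<omega> x y = 0"
proof (rule form_span_eq_0)
  show "y \<in> span (e ` {..j})" using assms(2) by (simp add: std_flag_def)
  show "\<omega> x s = 0" if "s \<in> e ` {..j}" for s
    using that assms mem_std_flag_iff[of i x] by auto
qed

lemma eq_0_if_form_basis_eq_0:
  assumes "\<And>i. i \<le> N \<Longrightarrow> \<omega> x (e i) = 0"
  shows "x = 0"
  using mem_span_basis_iff[of "{}" x] assms by simp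

section \<open>Splitting off hyperbolic planes\<close>

text \<open>
  The component of \<open>x\<close> orthogonal to the span of \<open>f i\<close>, \<open>i \<in> I\<close>, when the \<open>f i\<close> have the same Gram
  matrix as the \<open>e i\<close> and \<open>I\<close> is closed under \<open>i \<mapsto> N - i\<close>.
\<close>

definition residual :: "nat set \<Rightarrow> (nat \<Rightarrow> 'v) \<Rightarrow> 'v \<Rightarrow> 'v" where
  "residual I f x = x - (\<Sum>i\<in>I. scale (\<omega> x (f (N - i)) / \<omega> (e i) (e (N - i))) (f i))"

lemma form_residual_eq_0:
  assumes I: "I \<subseteq> {0..N}" "\<And>i. i \<in> I \<Longrightarrow> N - i \<in> I"
    and gram: "\<And>i j. i \<in> I \<Longrightarrow> j \<in> I \<Longrightarrow> \<omega> (f i) (f j) = \<omega> (e i) (e j)"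
    and j: "j \<in> I"
  shows "\<omega> (residual I f x) (f j) = 0"
proof -
  have j': "j \<le> N" "N - j \<in> I" "N - (N - j) = j" using I j by auto
  have "\<omega> (\<Sum>i\<in>I. scale (\<omega> x (f (N - i)) / \<omega> (e i) (e (N - i))) (f i)) (f j)
        = \<omega> x (f (N - (N - j))) / \<omega> (e (N - j)) (e (N - (N - j))) * \<omega> (f (N - j)) (f j)"
  proof (rule form_sum_antidiagonal)
    show "finite I" using I(1) finite_subset by blast
    show "N - j \<in> I" by (fact j'(2))
    fix i assume i: "i \<in> I" "i \<noteq> N - j"
    then have "i \<le> N" "i + j \<noteq> N" using I by auto
    then show "\<omega> (f i) (f j) = 0" using form_basis_eq_0 j' gram[OF i(1) j] by simp
  qed
  also have "\<dots> = \<omega> x (f j)"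
    using form_basis_conj_neq_0[of "N - j"] j' gram[OF j'(2) j] by simp
  finally show ?thesis by (simp add: residual_def form_diff_left)
qed

lemma sub_residual_mem:
  assumes "subspace W" "\<And>i. i \<in> I \<Longrightarrow> f i \<in> W \<or> \<omega> x (f (N - i)) = 0"
  shows "x - residual I f x \<in> W"
proof -
  have "scale (\<omega> x (f (N - i)) / \<omega> (e i) (e (N - i))) (f i) \<in> W" if "i \<in> I" for i
    using assms(2)[OF that] assms(1) by (auto intro: subspace_scale simp: subspace_0)
  then show ?thesis unfolding residual_def using assms(1) by (simp add: subspace_sum)
qed

lemma residual_mem:
  assumes "subspace W" "x \<in> W" "\<And>i. i \<in> I \<Longrightarrow> f i \<in> W \<or> \<omega> x (f (N - i)) = 0"
  shows "residual I f x \<in> W"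
proof -
  have "x - residual I f x \<in> W" using assms by (intro sub_residual_mem) auto
  from subspace_diff[OF assms(1,2) this] show ?thesis by simp
qed

text \<open>
  If \<open>f i\<close> is not known to lie in \<open>F j\<close>, then \<open>i > j\<close>, and its partner \<open>f (N - i)\<close> lies in the
  orthogonal space of \<open>F j\<close>; so \<open>f i\<close> does not enter the projection of \<open>x\<close>.
\<close>

lemma residual_mem_std_flag:
  assumes I: "I \<subseteq> {0..N}" "\<And>i. i \<in> I \<Longrightarrow> N - i \<in> I"
    and f: "\<And>i. i \<in> I \<Longrightarrow> f i \<in> F i" and "x \<in> F j"
  shows "residual I f x \<in> F j"
proof (rule residual_mem[OF subspace_std_flag \<open>x \<in> F j\<close>])
  fix i assume i: "i \<in> I"
  show "f i \<in> F j \<or> \<omega> x (f (N - i)) = 0"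
  proof (cases "i \<le> j")
    case True
    then show ?thesis using f[OF i] std_flag_mono by blast
  next
    case False
    then have "j + (N - i) < N" using I(1) i by auto
    then show ?thesis using std_flag_orthogonal \<open>x \<in> F j\<close> f[OF I(2)[OF i]] by blast
  qed
qed

text \<open>
  Here \<open>v\<close> has leading index \<open>a\<close>, like \<open>x\<close>. On \<open>F b\<close> the functionals \<open>\<omega> v\<close> and \<open>\<omega> x\<close> depend only on
  the coefficient of \<open>e b\<close>, hence are proportional. Consequently a vector orthogonal to an
  adapted family cannot have the leading index of one of its members.
\<close>

lemma conj_leading_index_fresh:
  assumes ab: "a + b = N" and v: "\<omega> v (e b) \<noteq> 0" "\<And>i. i < b \<Longrightarrow> \<omega> v (e i) = 0"
    and xy: "x \<in> F a" "y \<in> F b" "\<omega> x y \<noteq> 0"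
  shows "\<omega> v y \<noteq> 0"
proof
  assume vy: "\<omega> v y = 0"
  \<comment> \<open>the combination of \<open>v\<close> and \<open>x\<close> that is orthogonal to \<open>e b\<close>, hence to all of \<open>F b\<close>\<close>
  define z where "z = scale (\<omega> x (e b)) v - scale (\<omega> v (e b)) x"
  have "\<omega> z y = 0"
  proof (rule form_span_eq_0)
    show "y \<in> span (e ` {..b})" using xy by (simp add: std_flag_def)
    fix s assume "s \<in> e ` {..b}"
    then obtain i where i: "i \<le> b" "s = e i" by auto
    show "\<omega> z s = 0"
    proof (cases "i = b")
      case True
      then show ?thesis using i by (simp add: z_def form_diff_left form_scale_left)
    next
      case False
      then have "\<omega> x (e i) = 0" using mem_std_flag_iff[of a x] xy(1) ab i by auto
      then show ?thesis using v(2)[of i] False i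
        by (simp add: z_def form_diff_left form_scale_left)
    qed
  qed
  then show False using vy v(1) xy(3) by (simp add: z_def form_diff_left form_scale_left)
qed

definition paired_indices :: "(nat \<Rightarrow> nat) \<Rightarrow> nat \<Rightarrow> nat set" where
  "paired_indices a k = a ` {..<k} \<union> (\<lambda>l. N - a l) ` {..<k}"

text \<open>
  The first \<open>k\<close> hyperbolic planes of a symplectic basis adapted to the flags \<open>F\<close> and \<open>V\<close>; the value
  \<open>a l\<close> is the leading index of the vector that enlarges \<open>V l\<close> to \<open>V (l + 1)\<close>. The
  Gram matrix forces independence, and forces \<open>i\<close> to be the exact leading index of \<open>f i\<close>.
\<close>

definition adapted :: "(nat \<Rightarrow> 'v set) \<Rightarrow> nat \<Rightarrow> (nat \<Rightarrow> nat) \<Rightarrow> (nat \<Rightarrow> 'v) \<Rightarrow> bool" where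
  "adapted V k a f \<longleftrightarrow>
     (\<forall>l<k. a l \<le> N) \<and> inj_on a {..<k} \<and> (\<forall>l<k. \<forall>m<k. a l + a m \<noteq> N) \<and>
     (\<forall>i\<in>paired_indices a k. f i \<in> F i) \<and>
     (\<forall>i\<in>paired_indices a k. \<forall>j\<in>paired_indices a k. \<omega> (f i) (f j) = \<omega> (e i) (e j)) \<and>
     (\<forall>l<k. f (a l) \<in> V (l + 1))"

lemma isotropic_flagD:
  assumes "V \<in> isotropic_flags scale X \<beta> m" "i \<in> {1..m}"
  shows "subspace (V i)" "V i \<subseteq> X" "dim (V i) = i" "\<And>x y. x \<in> V i \<Longrightarrow> y \<in> V i \<Longrightarrow> \<beta> x y = 0"
  using assms by (auto simp: isotropic_flags_def)

lemma isotropic_flag_mono: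
  assumes V: "V \<in> isotropic_flags scale X \<beta> m" and "1 \<le> i" "i \<le> j" "j \<le> m"
  shows "V i \<subseteq> V j"
  using \<open>i \<le> j\<close> \<open>j \<le> m\<close>
proof (induction j rule: dec_induct)
  case (step k)
  then have "V k \<subset> V (k + 1)" using V \<open>1 \<le> i\<close> by (auto simp: isotropic_flags_def)
  then show ?case using step by auto
qed simp

text \<open>
  One step of a symplectic Gram-Schmidt process. The isotropy of \<open>V\<close> keeps the projection of a vector
  of \<open>V (k + 1)\<close> inside \<open>V (k + 1)\<close>: the vectors \<open>f (N - a l)\<close> enter the projection with coefficients
  that are pairings with \<open>f (a l) \<in> V (k + 1)\<close>, which vanish.
\<close>

lemma adapted_step:
  assumes V: "V \<in> isotropic_flags scale UNIV \<omega> (n + 1)" and k: "k \<le> n"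
    and ad: "adapted V k a f"
  shows "\<exists>a' f'. adapted V (Suc k) a' f'"
proof -
  define I where "I = paired_indices a k"
  have I: "I \<subseteq> {0..N}" "\<And>i. i \<in> I \<Longrightarrow> N - i \<in> I"
    using ad by (auto simp: I_def paired_indices_def adapted_def)
  have fF: "\<And>i. i \<in> I \<Longrightarrow> f i \<in> F i"
    and gram: "\<And>i j. i \<in> I \<Longrightarrow> j \<in> I \<Longrightarrow> \<omega> (f i) (f j) = \<omega> (e i) (e j)"
    using ad by (auto simp: I_def adapted_def)
  let ?W = "V (k + 1)" and ?U = "span (f ` a ` {..<k})"
  have W: "subspace ?W" "dim ?W = k + 1" "\<And>x y. x \<in> ?W \<Longrightarrow> y \<in> ?W \<Longrightarrow> \<omega> x y = 0"
    using isotropic_flagD[OF V, of "k + 1"] k by auto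
  have fW: "f (a l) \<in> ?W" if "l < k" for l
    using ad that isotropic_flag_mono[OF V, of "l + 1" "k + 1"] k by (auto simp: adapted_def)
  have split: "f i \<in> ?W \<inter> ?U \<or> \<omega> x (f (N - i)) = 0" if "i \<in> I" "x \<in> ?W" for i x
  proof -
    from \<open>i \<in> I\<close> obtain l where l: "l < k" "i = a l \<or> i = N - a l"
      by (auto simp: I_def paired_indices_def)
    have "a l \<le> N" using ad l by (simp add: adapted_def)
    then show ?thesis using l fW[OF l(1)] W(3)[OF \<open>x \<in> ?W\<close>] by (auto intro: span_base)
  qed
  \<comment> \<open>starting outside of the span of the earlier vectors keeps the projected vector nonzero\<close>
  have "dim ?U \<le> k"
    using dim_le_card[of "?U" "f ` a ` {..<k}"] card_image_le[of "{..<k}" "f \<circ> a"]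
    by (simp add: image_comp)
  then have "\<not> ?W \<subseteq> ?U" using dim_subset[of ?W ?U] W(2) by linarith
  then obtain x where x: "x \<in> ?W" "x \<notin> ?U" by blast
  define v where "v = residual I f x"
  have vW: "v \<in> ?W" unfolding v_def using residual_mem[OF W(1) x(1)] split x by blast
  have "x - v \<in> ?U" unfolding v_def using sub_residual_mem[OF subspace_span] split x by blast
  then have "v \<noteq> 0" using x(2) by auto
  have v_orth: "\<omega> v (f i) = 0" if "i \<in> I" for i
    unfolding v_def using form_residual_eq_0[OF I gram that] .
  \<comment> \<open>the least \<open>b\<close> with \<open>\<omega> v (e b) \<noteq> 0\<close> is the conjugate of the leading index \<open>p\<close> of \<open>v\<close>\<close>
  define b where "b = (LEAST i. \<omega> v (e i) \<noteq> 0)"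
  obtain i0 where i0: "i0 \<le> N" "\<omega> v (e i0) \<noteq> 0" using \<open>v \<noteq> 0\<close> eq_0_if_form_basis_eq_0 by blast
  have b: "\<omega> v (e b) \<noteq> 0" "\<And>i. i < b \<Longrightarrow> \<omega> v (e i) = 0"
    unfolding b_def using LeastI[of "\<lambda>i. \<omega> v (e i) \<noteq> 0", OF i0(2)] not_less_Least by blast+
  have "b \<le> N" unfolding b_def using Least_le[of "\<lambda>i. \<omega> v (e i) \<noteq> 0", OF i0(2)] i0(1) by linarith
  define p where "p = N - b"
  have pb: "p + b = N" "p \<le> N" "p \<noteq> b" using \<open>b \<le> N\<close> by (auto simp: p_def) presburger
  have vF: "v \<in> F p" using mem_std_flag_iff[of p v] b(2) pb by auto
  \<comment> \<open>\<open>p\<close> is new because \<open>v\<close> is orthogonal to the old family; then \<open>b = N - p\<close> is new as well\<close>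
  have pI: "p \<notin> I"
  proof
    assume p: "p \<in> I"
    then have bI: "b \<in> I" using I(2)[OF p] pb by (metis add_diff_cancel_left')
    have "\<omega> (f p) (f b) \<noteq> 0"
      using gram[OF p bI] form_basis_conj_neq_0[of p] pb by (metis add_diff_cancel_left')
    then have "\<omega> v (f b) \<noteq> 0" using conj_leading_index_fresh[OF pb(1) b fF fF] p bI by blast
    then show False using v_orth[OF bI] by blast
  qed
  have bI: "b \<notin> I" using I(2)[of b] pI p_def by auto
  \<comment> \<open>the partner of \<open>v\<close>: projecting \<open>e b\<close> changes neither its pairing with \<open>v\<close> nor its membership in \<open>F b\<close>\<close>
  define r where "r = residual I f (e b)"
  have r_orth: "\<omega> r (f i) = 0" if "i \<in> I" for i
    unfolding r_def using form_residual_eq_0[OF I gram that] .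
  have rF: "r \<in> F b"
    unfolding r_def by (rule residual_mem_std_flag[OF I fF]) (simp_all add: basis_mem_std_flag)
  have "\<omega> v (e b - r) = 0"
  proof -
    have "e b - r \<in> span (f ` I)" unfolding r_def
      by (rule sub_residual_mem) (auto intro: span_base)
    then show ?thesis by (rule form_span_eq_0) (use v_orth in auto)
  qed
  then have vr: "\<omega> v r \<noteq> 0" using b(1) form_add_right[of v "e b - r" r] by simp
  \<comment> \<open>scaled to the value for \<open>e\<close>, which is \<open>1\<close> or \<open>- 1\<close> according to whether \<open>p \<le> n\<close>\<close>
  define u where "u = scale (\<omega> (e p) (e b) / \<omega> v r) r"
  have uF: "u \<in> F b" unfolding u_def by (rule subspace_scale[OF subspace_std_flag rF])
  have u_orth: "\<omega> u (f i) = 0" if "i \<in> I" for i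
    using r_orth[OF that] by (simp add: u_def form_scale_left)
  have vu: "\<omega> v u = \<omega> (e p) (e b)" using vr by (simp add: u_def form_scale_right)
  define a' where "a' = a(k := p)"
  define f' where "f' = f(p := v, b := u)"
  have I': "paired_indices a' (Suc k) = insert p (insert b I)"
    using pb by (auto simp: I_def paired_indices_def a'_def lessThan_Suc p_def)
  have f'I: "f' i = f i" if "i \<in> I" for i using that pI bI by (auto simp: f'_def)
  have f'p: "f' p = v" and f'b: "f' b = u" using pb by (auto simp: f'_def)
  have e_orth: "\<omega> (e p) (e i) = 0" "\<omega> (e b) (e i) = 0" if "i \<in> I" for i
  proof -
    have "i \<le> N" "i \<noteq> b" "i \<noteq> p" using that I(1) bI pI by auto
    then show "\<omega> (e p) (e i) = 0" "\<omega> (e b) (e i) = 0" using form_basis_eq_0 pb \<open>b \<le> N\<close> by auto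
  qed
  have orth_swap: "\<omega> y x = 0" if "\<omega> x y = 0" for x y using form_swap[of y x] that by simp
  have gram': "\<omega> (f' i) (f' j) = \<omega> (e i) (e j)"
    if "i \<in> insert p (insert b I)" "j \<in> insert p (insert b I)" for i j
    using that vu form_swap[of u v] form_swap[of "e b" "e p"]
    by (auto simp: f'p f'b f'I gram v_orth u_orth e_orth orth_swap[OF v_orth] orth_swap[OF u_orth]
        orth_swap[OF e_orth(1)] orth_swap[OF e_orth(2)] form_self)
  have f'F: "f' i \<in> F i" if "i \<in> insert p (insert b I)" for i
    using that by (auto simp: f'p f'b f'I fF vF uF)
  have f'V: "f' (a' l) \<in> V (l + 1)" if "l < Suc k" for l
  proof (cases "l = k")
    case True
    then show ?thesis using vW by (simp add: a'_def f'p)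
  next
    case False
    then have "l < k" using that by simp
    then have "a l \<in> I" by (auto simp: I_def paired_indices_def)
    then show ?thesis using ad \<open>l < k\<close> by (simp add: a'_def f'I adapted_def)
  qed
  have a'N: "a' l \<le> N" if "l < Suc k" for l
    using that ad pb by (auto simp: a'_def adapted_def)
  have aI: "a l \<noteq> p" "a l \<noteq> b" if "l < k" for l
    using that pI bI by (auto simp: I_def paired_indices_def)
  have "inj_on a {..<k}" using ad by (simp add: adapted_def)
  moreover have "p \<notin> a ` {..<k}" using aI(1) by auto
  ultimately have inj': "inj_on a' {..<Suc k}"
    using inj_on_fun_updI[of a "{..<k}" p k] by (simp add: a'_def lessThan_Suc)
  have a'a': "a' l + a' m \<noteq> N" if "l < Suc k" "m < Suc k" for l m
  proof -
    have "a l + p \<noteq> N" "p + a l \<noteq> N" if "l < k" for l using aI[OF that] pb by auto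
    moreover have "p + p \<noteq> N" using pb by auto
    ultimately show ?thesis using that ad by (auto simp: a'_def adapted_def less_Suc_eq)
  qed
  have "adapted V (Suc k) a' f'"
    unfolding adapted_def I' using a'N inj' a'a' f'F gram' f'V by (intro conjI allI ballI impI)
  then show ?thesis by blast
qed

lemma adapted_exists:
  assumes V: "V \<in> isotropic_flags scale UNIV \<omega> (n + 1)" and "k \<le> n + 1"
  shows "\<exists>a f. adapted V k a f"
  using \<open>k \<le> n + 1\<close>
proof (induction k)
  case 0
  show ?case by (auto simp: adapted_def paired_indices_def)
next
  case (Suc k)
  then show ?case using adapted_step[OF V] by auto
qed

section \<open>The Bruhat decomposition of the isotropic flag variety\<close>

definition coordinate_flag :: "(nat \<Rightarrow> nat) \<Rightarrow> nat \<Rightarrow> 'v set" where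
  "coordinate_flag w = (\<lambda>i\<in>{1..n + 1}. span (e ` w ` {..<i}))"

lemma dim_span_basis:
  assumes "A \<subseteq> {0..N}"
  shows "dim (span (e ` A)) = card A"
proof -
  have "independent (e ` A)" by (rule independent_mono[OF independent_basis]) (use assms in auto)
  moreover have "card (e ` A) = card A"
    using inj_basis assms by (meson card_image inj_on_subset)
  ultimately show ?thesis using dim_span_eq_card_independent by metis
qed

lemma dim_std_flag: "j \<le> N \<Longrightarrow> dim (F j) = j + 1"
  unfolding std_flag_def by (subst dim_span_basis) auto

lemma weyl_le:
  assumes "w \<in> weyl_Sp_even n" "k \<le> N"
  shows "w k \<le> N" "w (N - k) = N - w k"
proof -
  have "w permutes {0..N}" using assms(1) by (simp add: weyl_Sp_even_def)
  then show "w k \<le> N" using permutes_in_image[of w "{0..N}" k] assms(2) by simp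
  show "w (N - k) = N - w k" using assms by (simp add: weyl_Sp_even_def conj_index_def)
qed

lemma weyl_inj: "w \<in> weyl_Sp_even n \<Longrightarrow> inj w"
  by (auto simp: weyl_Sp_even_def dest: permutes_inj)

lemma coordinate_flag_isotropic:
  assumes w: "w \<in> weyl_Sp_even n"
  shows "coordinate_flag w \<in> isotropic_flags scale UNIV \<omega> (n + 1)"
proof -
  have sub: "w ` {..<i} \<subseteq> {0..N}" if "i \<le> n + 1" for i
  proof -
    have "k \<le> N" if "k < i" for k using that \<open>i \<le> n + 1\<close> by linarith
    then show ?thesis using weyl_le(1)[OF w] by (simp add: image_subset_iff)
  qed
  have d: "dim (span (e ` w ` {..<i})) = i" if "i \<le> n + 1" for i
    using dim_span_basis[OF sub[OF that]] card_image[OF inj_on_subset[OF weyl_inj[OF w]], of "{..<i}"]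
    by simp
  have "\<omega> x y = 0" if i: "i \<le> n + 1" and xy: "x \<in> span (e ` w ` {..<i})" "y \<in> span (e ` w ` {..<i})"
    for i x y
  proof (rule form_span_eq_0[OF xy(2)])
    fix s assume "s \<in> e ` w ` {..<i}"
    then obtain k where k: "k < i" "s = e (w k)" by blast
    have "k \<le> N" using k(1) i by linarith
    then have kN: "k \<le> N" "w k \<le> N" using weyl_le(1)[OF w] by blast+
    have "N - w k \<notin> w ` {..<i}"
    proof
      assume "N - w k \<in> w ` {..<i}"
      then obtain l where "l < i" "w (N - k) = w l"
        unfolding weyl_le(2)[OF w kN(1), symmetric] by blast
      then show False using injD[OF weyl_inj[OF w], of "N - k" l] k i by linarith
    qed
    then show "\<omega> x s = 0" using mem_span_basis_iff[OF sub[OF i], of x] xy(1) kN k by blast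
  qed
  moreover have "span (e ` w ` {..<i}) \<subset> span (e ` w ` {..<i + 1})" if "i \<le> n" for i
  proof -
    have "span (e ` w ` {..<i}) \<subseteq> span (e ` w ` {..<i + 1})"
      by (intro span_mono image_mono) auto
    moreover have "dim (span (e ` w ` {..<i})) \<noteq> dim (span (e ` w ` {..<i + 1}))"
      using d[of i] d[of "i + 1"] that by simp
    ultimately show ?thesis by (metis psubsetI)
  qed
  ultimately show ?thesis using d by (auto simp: isotropic_flags_def coordinate_flag_def)
qed

text \<open>Intersecting two coordinate subspaces intersects their index sets.\<close>

lemma coordinate_flag_in_cell:
  assumes w: "w \<in> weyl_Sp_even n"
  shows "coordinate_flag w \<in> schubert_cell scale \<omega> e n w"
proof -
  have "dim (coordinate_flag w (i + 1) \<inter> F j) = card {k \<in> {0..i}. w k \<le> j}"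
    if ij: "i \<le> n" "j \<le> N" for i j
  proof -
    have sub: "w ` {..<i + 1} \<subseteq> {0..N}" "{..j} \<subseteq> {0..N}"
    proof -
      have "w k \<in> {0..N}" if "k < i + 1" for k
      proof -
        have "k \<le> N" using that ij(1) by linarith
        then show ?thesis using weyl_le(1)[OF w] by simp
      qed
      then show "w ` {..<i + 1} \<subseteq> {0..N}" by blast
      show "{..j} \<subseteq> {0..N}" using ij(2) by auto
    qed
    then have "w ` {..<i + 1} \<inter> {..j} \<subseteq> {0..N}" by auto
    note iff = mem_span_basis_iff[OF this] mem_span_basis_iff[OF sub(1)] mem_span_basis_iff[OF sub(2)]
    have "coordinate_flag w (i + 1) \<inter> F j = span (e ` (w ` {..<i + 1} \<inter> {..j}))"
    proof (rule Set.set_eqI)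
      fix x
      show "x \<in> coordinate_flag w (i + 1) \<inter> F j \<longleftrightarrow> x \<in> span (e ` (w ` {..<i + 1} \<inter> {..j}))"
        unfolding iff std_flag_def Int_iff using ij(1) iff(2)[of x] iff(3)[of x]
        by (simp add: coordinate_flag_def del: lessThan_iff atMost_iff) blast
    qed
    also have "dim \<dots> = card (w ` {..<i + 1} \<inter> {..j})"
      using sub by (intro dim_span_basis) auto
    also have "w ` {..<i + 1} \<inter> {..j} = w ` {k \<in> {0..i}. w k \<le> j}" by auto
    also have "card \<dots> = card {k \<in> {0..i}. w k \<le> j}"
      using weyl_inj[OF w] by (meson card_image inj_on_subset subset_UNIV)
    finally show ?thesis .
  qed
  then show ?thesis using coordinate_flag_isotropic[OF w] by (simp add: schubert_cell_def)
qed

text \<open>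
  The jumps in \<open>i\<close> of the dimensions defining the cell tell for each \<open>j\<close> whether \<open>w i \<le> j\<close>, which
  determines \<open>w\<close> on \<open>{0..n}\<close>.
\<close>

lemma cell_determines_coordinate_flag:
  assumes w: "w \<in> weyl_Sp_even n" "w' \<in> weyl_Sp_even n"
    and V: "V \<in> schubert_cell scale \<omega> e n w" "V \<in> schubert_cell scale \<omega> e n w'"
  shows "coordinate_flag w = coordinate_flag w'"
proof -
  have c: "card {k \<in> {0..i}. w k \<le> j} = card {k \<in> {0..i}. w' k \<le> j}" if "i \<le> n" "j \<le> N" for i j
    using V that by (simp add: schubert_cell_def)
  have rec: "card {k \<in> {0..i}. u k \<le> j} = card {k \<in> {0..<i}. u k \<le> j} + (if u i \<le> j then 1 else 0)"
    for u :: "nat \<Rightarrow> nat" and i j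
  proof -
    have "{k \<in> {0..i}. u k \<le> j} = {k \<in> {0..<i}. u k \<le> j} \<union> (if u i \<le> j then {i} else {})"
      by (auto simp: le_less)
    also have "card \<dots> = card {k \<in> {0..<i}. u k \<le> j} + card (if u i \<le> j then {i} else {})"
      by (intro card_Un_disjoint) auto
    finally show ?thesis by simp
  qed
  have c': "card {k \<in> {0..<i}. w k \<le> j} = card {k \<in> {0..<i}. w' k \<le> j}" if "i \<le> n" "j \<le> N" for i j
    using c[of "i - 1" j] that by (cases i) (simp_all add: atLeastLessThanSuc_atLeastAtMost)
  have le: "w i \<le> j \<longleftrightarrow> w' i \<le> j" if "i \<le> n" "j \<le> N" for i j
    using c[OF that] c'[OF that] rec[of i w j] rec[of i w' j] by (auto split: if_splits)
  have "w i = w' i" if "i \<le> n" for i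
    using le[OF that, of "w i"] le[OF that, of "w' i"] weyl_le(1)[OF w(1), of i] weyl_le(1)[OF w(2), of i] that
    by (intro antisym) auto
  then have "w ` {..<i} = w' ` {..<i}" if "i \<le> n + 1" for i
    using that by (intro image_cong) auto
  then show ?thesis by (auto simp: coordinate_flag_def restrict_def fun_eq_iff)
qed

text \<open>
  Once all \<open>n + 1\<close> planes are found, their \<open>2 * n + 2\<close> indices exhaust \<open>{0..N}\<close>, and the
  index function \<open>a\<close> on \<open>{0..n}\<close> extends to a Weyl group element by \<open>w (N - k) = N - w k\<close>.
\<close>

lemma adapted_weyl:
  assumes "adapted V (n + 1) a f"
  obtains w where "w \<in> weyl_Sp_even n" "\<And>k. k \<le> n \<Longrightarrow> w k = a k" "paired_indices a (n + 1) = {0..N}"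
proof
  define w where "w k = (if k \<le> n then a k else if k \<le> N then N - a (N - k) else k)" for k
  have a: "a k \<le> N" "a k = a l \<longleftrightarrow> k = l" "a k + a l \<noteq> N" if "k \<le> n" "l \<le> n" for k l
    using assms that by (auto simp: adapted_def inj_on_def)
  have inj: "inj_on w {0..N}"
  proof (rule inj_onI)
    fix k l assume kl: "k \<in> {0..N}" "l \<in> {0..N}" "w k = w l"
    have kl': "k \<le> N" "l \<le> N" using kl by auto
    consider "k \<le> n" "l \<le> n" | "k \<le> n" "\<not> l \<le> n" | "\<not> k \<le> n" "l \<le> n" | "\<not> k \<le> n" "\<not> l \<le> n"
      by blast
    then show "k = l"
    proof cases
      case 1
      then show ?thesis using kl(3) a(2)[of k l] by (simp add: w_def)
    next
      case 2
      then have "a k = N - a (N - l)" "N - l \<le> n" using kl(3) kl' by (auto simp: w_def)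
      then show ?thesis using a(3)[of k "N - l"] a(1)[of "N - l" "N - l"] 2(1) by linarith
    next
      case 3
      then have "N - a (N - k) = a l" "N - k \<le> n" using kl(3) kl' by (auto simp: w_def)
      then show ?thesis using a(3)[of "N - k" l] a(1)[of "N - k" "N - k"] 3(2) by linarith
    next
      case 4
      then have "N - a (N - k) = N - a (N - l)" and *: "N - k \<le> n" "N - l \<le> n"
        using kl(3) kl' by (auto simp: w_def)
      then have "a (N - k) = a (N - l)" using a(1)[OF *(1) *(1)] a(1)[OF *(2) *(2)] by linarith
      then show ?thesis using a(2)[OF *] kl' by linarith
    qed
  qed
  have into: "w ` {0..N} \<subseteq> {0..N}" using a(1) by (auto simp: w_def)
  have onto: "w ` {0..N} = {0..N}" using endo_inj_surj[OF _ into inj] by simp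
  have "w permutes {0..N}"
    using inj onto by (intro bij_imp_permutes) (auto simp: bij_betw_def w_def)
  moreover have "w (N - k) = N - w k" if "k \<le> N" for k
    using that a(1)[of k k] a(1)[of "N - k" "N - k"] by (auto simp: w_def)
  ultimately show "w \<in> weyl_Sp_even n" by (simp add: weyl_Sp_even_def conj_index_def)
  show "w k = a k" if "k \<le> n" for k using that by (simp add: w_def)
  have "w ` {0..N} \<subseteq> paired_indices a (n + 1)"
    unfolding paired_indices_def w_def by (auto simp: image_iff)
  moreover have "paired_indices a (n + 1) \<subseteq> {0..N}"
    using assms by (auto simp: adapted_def paired_indices_def)
  ultimately show "paired_indices a (n + 1) = {0..N}" using onto by blast
qed

lemma form_preserving_if_basis:
  assumes g: "Vector_Spaces.linear scale scale g"
    and gram: "\<And>i j. i \<le> N \<Longrightarrow> j \<le> N \<Longrightarrow> \<omega> (g (e i)) (g (e j)) = \<omega> (e i) (e j)"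
  shows "\<omega> (g x) (g y) = \<omega> x y"
proof -
  interpret g: Vector_Spaces.linear scale scale g by fact
  have all: "z \<in> span (e ` {0..N})" for z using span_basis by simp
  have left: "\<omega> (g x) (g (e j)) = \<omega> x (e j)" if "j \<le> N" for x j
    using all[of x]
    by (induction rule: span_induct_alt)
      (auto simp: g.zero g.add g.scale form_zero_left form_add_left form_scale_left gram[OF _ that])
  show ?thesis
    using all[of y]
    by (induction rule: span_induct_alt)
      (auto simp: g.zero g.add g.scale form_zero_right form_add_right form_scale_right left)
qed

text \<open>A vector in the kernel of \<open>g\<close> is in the kernel of the form.\<close>

lemma inj_if_form_preserving:
  assumes g: "Vector_Spaces.linear scale scale g" and pres: "\<And>x y. \<omega> (g x) (g y) = \<omega> x y"
  shows "inj g"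
proof -
  interpret g: Vector_Spaces.linear scale scale g by fact
  have kernel: "x = 0" if "g x = 0" for x
    by (rule eq_0_if_form_basis_eq_0) (metis pres that form_zero_left)
  show ?thesis
  proof (rule injI)
    fix x y assume "g x = g y"
    then show "x = y" using kernel[of "x - y"] by (simp add: g.diff)
  qed
qed

text \<open>
  The map taking \<open>e\<close> to the adapted basis sends each \<open>F j\<close> into \<open>F j\<close> and each step of the coordinate
  flag into the corresponding step of \<open>V\<close>; it is injective, so equality follows from dimensions.
\<close>

lemma bruhat_decomposition:
  assumes V: "V \<in> isotropic_flags scale UNIV \<omega> (n + 1)"
  obtains w g where "w \<in> weyl_Sp_even n" "Vector_Spaces.linear scale scale g" "inj g"
    "\<And>x y. \<omega> (g x) (g y) = \<omega> x y"
    "\<And>j. j \<le> N \<Longrightarrow> g ` F j = F j"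
    "\<And>i. i \<in> {1..n + 1} \<Longrightarrow> g ` coordinate_flag w i = V i"
proof -
  interpret vector_space_pair scale scale ..
  obtain a f where af: "adapted V (n + 1) a f" using adapted_exists[OF V] by blast
  obtain w where w: "w \<in> weyl_Sp_even n" "\<And>k. k \<le> n \<Longrightarrow> w k = a k"
    and all: "paired_indices a (n + 1) = {0..N}"
    using adapted_weyl[OF af] by blast
  obtain g where g: "Vector_Spaces.linear scale scale g"
      "\<forall>x\<in>e ` {0..N}. g x = f (inv_into {0..N} e x)"
    using linear_independent_extend[OF independent_basis, of "\<lambda>x. f (inv_into {0..N} e x)"] by blast
  interpret g: Vector_Spaces.linear scale scale g by fact
  have ge: "g (e i) = f i" if "i \<le> N" for i using g(2) that inj_basis by simp
  have pres: "\<omega> (g x) (g y) = \<omega> x y" for x y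
    by (rule form_preserving_if_basis[OF g(1)]) (use af all in \<open>auto simp: ge adapted_def\<close>)
  have inj: "inj g" by (rule inj_if_form_preserving[OF g(1) pres])
  have dim_g: "dim (g ` S) = dim S" if "subspace S" for S
    using linear_on_image(2)[OF vector_space_axioms _ _ that, of UNIV g] inj
    by (simp add: linear_on_def g.add g.scale)
  have image_eq: "g ` span (e ` A) = W"
    if "A \<subseteq> {0..N}" "subspace W" "\<And>i. i \<in> A \<Longrightarrow> f i \<in> W" "dim W = card A" for A W
  proof (rule subspace_dim_equal)
    show "subspace (g ` span (e ` A))" by (simp add: g.subspace_image)
    have "g ` e ` A \<subseteq> W" using that ge by auto
    then show "g ` span (e ` A) \<subseteq> W" using that(2) g.span_image span_minimal by metis
    show "dim W \<le> dim (g ` span (e ` A))" using dim_g dim_span_basis that by simp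
    show "subspace W" by (fact that(2))
  qed
  have "g ` F j = F j" if j: "j \<le> N" for j
  proof -
    have "f i \<in> F j" if "i \<in> {..j}" for i
      using af all that j std_flag_mono[of i j] by (auto simp: adapted_def)
    then have "g ` span (e ` {..j}) = F j"
      using j dim_std_flag[OF j] by (intro image_eq) (auto simp: subspace_std_flag)
    then show ?thesis by (simp add: std_flag_def)
  qed
  moreover have "g ` coordinate_flag w i = V i" if i: "i \<in> {1..n + 1}" for i
  proof -
    have "f (w k) \<in> V i" if "k < i" for k
      using af w(2)[of k] that i isotropic_flag_mono[OF V, of "k + 1" i] by (auto simp: adapted_def)
    moreover have "card (w ` {..<i}) = i"
      using card_image[OF inj_on_subset[OF weyl_inj[OF w(1)]], of "{..<i}"] by simp
    ultimately have "g ` span (e ` w ` {..<i}) = V i"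
      using i weyl_le(1)[OF w(1)] isotropic_flagD[OF V i] by (intro image_eq) auto
    then show ?thesis using i by (simp add: coordinate_flag_def)
  qed
  ultimately show thesis using that w(1) g(1) inj pres by blast
qed

end

section \<open>Restriction to the odd symplectic space\<close>

locale odd_symplectic_basis = symplectic_basis +
  fixes E and \<beta>
  assumes E_eq: "E = std_flag scale e (2 * n)"
    and form_restrict: "\<forall>u\<in>E. \<forall>v\<in>E. \<omega> u v = \<beta> u v"
begin

abbreviation "X \<equiv> isotropic_flags scale E \<beta> (n + 1)"
abbreviation "B \<equiv> borel_Sp_odd scale E \<beta> e n"
abbreviation "act \<equiv> flag_action scale E \<beta> (n + 1)"
abbreviation "cell \<equiv> schubert_cell scale \<omega> e n"

sublocale action: group_action B X act
  by (rule group_action_flag_action[OF vector_space_axioms E_eq])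

lemma isotropic_flags_odd_iff:
  "V \<in> X \<longleftrightarrow> V \<in> isotropic_flags scale UNIV \<omega> (n + 1) \<and> V (n + 1) \<subseteq> E"
proof
  assume V: "V \<in> X"
  have "\<omega> u v = 0" if "u \<in> V i" "v \<in> V i" "i \<in> {1..n + 1}" for u v i
    using isotropic_flagD(2,4)[OF V that(3)] that form_restrict by (metis subsetD)
  then show "V \<in> isotropic_flags scale UNIV \<omega> (n + 1) \<and> V (n + 1) \<subseteq> E"
    using V unfolding isotropic_flags_def by simp
next
  assume V: "V \<in> isotropic_flags scale UNIV \<omega> (n + 1) \<and> V (n + 1) \<subseteq> E"
  then have sub: "V i \<subseteq> E" if "i \<in> {1..n + 1}" for i
    using isotropic_flag_mono[of V UNIV \<omega> "n + 1" i "n + 1"] that by auto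
  moreover have "\<beta> u v = 0" if "u \<in> V i" "v \<in> V i" "i \<in> {1..n + 1}" for u v i
    using sub[OF that(3)] isotropic_flagD(4)[OF conjunct1[OF V] that(3)] that form_restrict
    by (metis subsetD)
  ultimately show "V \<in> X" using V unfolding isotropic_flags_def by simp
qed

text \<open>
  An \<open>(n + 1)\<close>-dimensional space lies in \<open>E = F (2 * n)\<close> if and only if its intersection with
  \<open>F (2 * n)\<close> has dimension \<open>n + 1\<close>, and this dimension is constant on a cell.
\<close>

lemma cell_subset_odd_flags:
  assumes V: "V \<in> cell w" "V \<in> X"
  shows "cell w \<subseteq> X"
proof
  fix V' assume V': "V' \<in> cell w"
  have iso: "V' \<in> isotropic_flags scale UNIV \<omega> (n + 1)" using V' by (simp add: schubert_cell_def)
  have "dim (V' (n + 1) \<inter> E) = dim (V (n + 1) \<inter> E)"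
    using V(1) V' by (simp add: schubert_cell_def E_eq)
  also have "V (n + 1) \<inter> E = V (n + 1)" using V(2) isotropic_flags_odd_iff by blast
  also have "dim \<dots> = dim (V' (n + 1))"
    using isotropic_flagD(3)[OF V(2)] isotropic_flagD(3)[OF iso] by simp
  finally have "V' (n + 1) \<inter> E = V' (n + 1)"
    using isotropic_flagD(1)[OF iso] by (intro subspace_dim_equal) (auto simp: subspace_inter E_eq subspace_std_flag)
  then show "V' \<in> X" using iso isotropic_flags_odd_iff by blast
qed

text \<open>
  For \<open>j \<le> 2 * n\<close> an element of the Borel subgroup maps the intersection with \<open>F j\<close> isomorphically.
  It does not act on \<open>F N\<close>, the whole space, but there the dimension condition only records
  the dimension of the step of the flag.
\<close>

lemma borel_preserves_cell:
  assumes b: "b \<in> carrier B" and V: "V \<in> cell w" "V \<in> X"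
  shows "act b V \<in> cell w"
proof -
  have bij: "bij_betw b E E" and lin: "linear_on scale E b"
    and flag: "\<And>j. j \<le> 2 * n \<Longrightarrow> b ` F j = F j"
    using b by (auto simp: borel_Sp_odd_carrier Bij_def)
  have inj: "inj_on b E" using bij by (simp add: bij_betw_def)
  have actV: "act b V i = b ` V i" if "i \<in> {1..n + 1}" for i
    using V(2) that by (simp add: flag_action_def)
  have mem: "act b V \<in> X" using action.element_image[OF b V(2)] by simp
  have "dim (act b V (i + 1) \<inter> F j) = dim (V (i + 1) \<inter> F j)" if ij: "i \<le> n" "j \<le> N" for i j
  proof (cases "j = N")
    case True
    then show ?thesis
      using isotropic_flagD(3)[OF V(2), of "i + 1"] isotropic_flagD(3)[OF mem, of "i + 1"] ij
      by (simp add: std_flag_top del: add_2_eq_Suc add_2_eq_Suc' One_nat_def)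
  next
    case False
    then have j: "j \<le> 2 * n" using ij by simp
    have Vi: "subspace (V (i + 1))" "V (i + 1) \<subseteq> E" using isotropic_flagD[OF V(2), of "i + 1"] ij by auto
    have "F j \<subseteq> E" unfolding E_eq by (rule std_flag_mono[OF j])
    then have "b ` (V (i + 1) \<inter> F j) = b ` V (i + 1) \<inter> F j"
      using inj_on_image_Int[OF inj Vi(2)] flag[OF j] by metis
    moreover have "dim (b ` (V (i + 1) \<inter> F j)) = dim (V (i + 1) \<inter> F j)"
      using Vi subspace_std_flag
      by (intro linear_on_image(2)[OF vector_space_axioms lin inj]) (auto simp: subspace_inter)
    ultimately show ?thesis using actV[of "i + 1"] ij by simp
  qed
  then show ?thesis using V(1) mem isotropic_flags_odd_iff by (simp add: schubert_cell_def)
qed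

text \<open>
  The element of the even symplectic group taking a coordinate flag to \<open>V\<close> preserves \<open>E = F (2 * n)\<close>.
  Its restriction to \<open>E\<close> is in the Borel subgroup, and the coordinate flag lies in \<open>E\<close>
  because \<open>V\<close> does.
\<close>

lemma odd_bruhat_decomposition:
  assumes V: "V \<in> X"
  obtains w b where "w \<in> weyl_Sp_even n" "coordinate_flag w \<in> X" "b \<in> carrier B"
    "act b (coordinate_flag w) = V"
proof -
  obtain w g where w: "w \<in> weyl_Sp_even n" and g: "Vector_Spaces.linear scale scale g" "inj g"
    "\<And>x y. \<omega> (g x) (g y) = \<omega> x y" "\<And>j. j \<le> N \<Longrightarrow> g ` F j = F j"
    and gV: "\<And>i. i \<in> {1..n + 1} \<Longrightarrow> g ` coordinate_flag w i = V i"
    using bruhat_decomposition V isotropic_flags_odd_iff by metis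
  interpret g: Vector_Spaces.linear scale scale g by fact
  have gE: "g ` E = E" using g(4)[of "2 * n"] E_eq by simp
  have "g ` coordinate_flag w (n + 1) \<subseteq> g ` E"
    using gV[of "n + 1"] V isotropic_flags_odd_iff gE by auto
  then have "coordinate_flag w (n + 1) \<subseteq> E" using g(2) by (simp add: inj_image_subset_iff)
  then have cX: "coordinate_flag w \<in> X"
    using coordinate_flag_isotropic[OF w] isotropic_flags_odd_iff by blast
  define b where "b = restrict g E"
  have sE: "subspace E" by (simp add: E_eq subspace_std_flag)
  have bS: "b ` S = g ` S" if "S \<subseteq> E" for S using that by (force simp: b_def)
  have "b \<in> Bij E"
    using gE g(2) by (auto simp: b_def Bij_def bij_betw_def inj_on_def)
  moreover have "linear_on scale E b"
    using sE by (simp add: linear_on_def b_def g.add g.scale subspace_add subspace_scale)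
  moreover have "\<beta> (b u) (b v) = \<beta> u v" if "u \<in> E" "v \<in> E" for u v
  proof -
    have "g u \<in> E" "g v \<in> E" using that gE by auto
    then show ?thesis using that form_restrict g(3)[of u v] by (simp add: b_def)
  qed
  moreover have "b ` F j = F j" if "j \<le> 2 * n" for j
    using bS[of "F j"] g(4)[of j] that std_flag_mono[OF that] by (simp add: E_eq)
  ultimately have b: "b \<in> carrier B" by (simp add: borel_Sp_odd_carrier)
  have "act b (coordinate_flag w) i = V i" for i
  proof (cases "i \<in> {1..n + 1}")
    case True
    then show ?thesis using cX gV bS isotropic_flagD(2)[OF cX] by (simp add: flag_action_def)
  next
    case False
    then have "V i = undefined" using V by (simp only: isotropic_flags_def extensional_def) auto
    then show ?thesis using False cX by (simp only: flag_action_def) auto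
  qed
  then show thesis using that w cX b by blast
qed

text \<open>
  Every flag in the cell is a translate of some coordinate flag, which lies in the same cell and is
  therefore the coordinate flag of \<open>w\<close>.
\<close>

lemma orbit_eq_cell:
  assumes w: "w \<in> weyl_Sp_even n" and V: "V \<in> cell w" "V \<in> X"
  shows "orbit B act V = cell w"
proof
  show "orbit B act V \<subseteq> cell w" using borel_preserves_cell V by (auto simp: orbit_def)
  have through: "U \<in> orbit B act (coordinate_flag w) \<and> coordinate_flag w \<in> X" if U: "U \<in> cell w" "U \<in> X" for U
  proof -
    obtain w' b where w': "w' \<in> weyl_Sp_even n" "coordinate_flag w' \<in> X" and b: "b \<in> carrier B"
      "act b (coordinate_flag w') = U" using odd_bruhat_decomposition[OF U(2)] by blast
    have "U \<in> cell w'" using borel_preserves_cell[OF b(1) coordinate_flag_in_cell] w' b(2) by blast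
    then have "coordinate_flag w' = coordinate_flag w"
      using cell_determines_coordinate_flag[OF w'(1) w] U(1) by blast
    then show ?thesis using w' b by (auto simp: orbit_def)
  qed
  show "cell w \<subseteq> orbit B act V"
  proof
    fix U assume U: "U \<in> cell w"
    then have "U \<in> X" using cell_subset_odd_flags[OF V] by blast
    then show "U \<in> orbit B act V"
      using through[OF U] through[OF V] V(2) action.orbit_sym action.orbit_trans by meson
  qed
qed

theorem odd_schubert_cells_eq_orbits:
  "odd_schubert_cells scale E \<beta> \<omega> e n = orbits B X act"
proof (intro equalityI subsetI)
  fix C assume "C \<in> odd_schubert_cells scale E \<beta> \<omega> e n"
  then obtain w where w: "w \<in> weyl_Sp_even n" "C = cell w" "cell w \<subseteq> X"
    by (auto simp: odd_schubert_cells_def)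
  have "coordinate_flag w \<in> cell w" by (rule coordinate_flag_in_cell[OF w(1)])
  then have "C = orbit B act (coordinate_flag w)" "coordinate_flag w \<in> X"
    using orbit_eq_cell[OF w(1)] w by auto
  then show "C \<in> orbits B X act" by (auto simp: orbits_def)
next
  fix C assume "C \<in> orbits B X act"
  then obtain V where V: "V \<in> X" "C = orbit B act V" by (auto simp: orbits_def)
  obtain w b where w: "w \<in> weyl_Sp_even n" "coordinate_flag w \<in> X" and b: "b \<in> carrier B"
    "act b (coordinate_flag w) = V" using odd_bruhat_decomposition[OF V(1)] by blast
  have "V \<in> cell w" using borel_preserves_cell[OF b(1) coordinate_flag_in_cell] w b(2) by blast
  then have "C = cell w" "cell w \<subseteq> X"
    using orbit_eq_cell[OF w(1)] cell_subset_odd_flags V by auto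
  then show "C \<in> odd_schubert_cells scale E \<beta> \<omega> e n" using w(1) by (auto simp: odd_schubert_cells_def)
qed

end

theorem proposition4p24:
  fixes scale :: "complex \<Rightarrow> 'v::ab_group_add \<Rightarrow> 'v"
    and n :: nat
    and E :: "'v set"
    and \<omega> \<omega>' :: "'v \<Rightarrow> 'v \<Rightarrow> complex"
    and e :: "nat \<Rightarrow> 'v"
  assumes "vector_space scale"
    and "vector_space.dim scale UNIV = 2 * n + 2"
    and "module.subspace scale E"
    and "vector_space.dim scale E = 2 * n + 1"
    and "skew_form_on scale E \<omega>"
    and "form_rank scale E \<omega> = 2 * n"
    and "symplectic_form_on scale UNIV \<omega>'"
    and "\<forall>u\<in>E. \<forall>v\<in>E. \<omega>' u v = \<omega> u v"
    and "inj_on e {0..2 * n + 1}"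
    and "\<not> module.dependent scale (e ` {0..2 * n + 1})"
    and "module.span scale (e ` {0..2 * n + 1}) = UNIV"
    and "E = module.span scale (e ` {0..2 * n})"
    and "\<forall>i\<in>{0..2 * n + 1}. \<forall>j\<in>{0..2 * n + 1}. j \<noteq> conj_index n i \<longrightarrow> \<omega>' (e i) (e j) = 0"
    and "\<forall>i\<in>{0..n}. \<omega>' (e i) (e (conj_index n i)) = 1"
  shows "odd_schubert_cells scale E \<omega> \<omega>' e n =
         orbits (borel_Sp_odd scale E \<omega> e n) (isotropic_flags scale E \<omega> (n + 1))
           (flag_action scale E \<omega> (n + 1))"
proof -
  interpret vector_space scale by fact
  have "{..2 * n} = {0..2 * n}" by auto
  then have "E = std_flag scale e (2 * n)" using assms(12) by (simp only: std_flag_def)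
  then interpret odd_symplectic_basis scale \<omega>' e n E \<omega>
    by unfold_locales (use assms in \<open>simp_all only: symplectic_form_on_def not_False_eq_True\<close>)
  show ?thesis by (rule odd_schubert_cells_eq_orbits)
qed

end
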